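(* Let $K$ be a field of characteristic $0$, let $V$ be a $K$-vector space of finite dimension $n\ge 2$, let $B:V\times V\to K$ be a non-degenerate symmetric bilinear form, and let $w\in V\setminus\{0\}$. Then the decomposition $\mathrm{End}_K(V)=E^{(0)}(B,w)\oplus E^{(1)}(B,w)$ (orthogonal with respect to the symmetric bilinear form $(\phi_1,\phi_2)\mapsto\mathrm{Tr}(\phi_1^\dagger\phi_2)$) defines a superalgebra structure on $\mathrm{End}_K(V)$, i.e. $E^{(i)}(B,w)\,E^{(j)}(B,w)\subseteq E^{(i+j \bmod 2)}(B,w)$ for all $i,j\in\{0,1\}$.
   Context: Write $\{w\}_B^\perp=\{u\in V : B(u,w)=0\}$. The subspaces of $\mathrm{End}_K(V)$ are $$E^{(0)}(B,w)=\{\phi\in\mathrm{End}_K(V) : B(u,\phi(w))=B(w,\phi(u))=0 \text{ for all } u\in\{w\}_B^\perp\},$$ $$E^{(1)}(B,w)=\{\phi\in\mathrm{End}_K(V) : B(u,\phi(v))=0 \text{ for all } u,v\in\{w\}_B^\perp,\ \text{and } B(w,\phi(w))=0\}.$$ For $\phi\in\mathrm{End}_K(V)$, $\phi^\dagger$ denotes the adjoint of $\phi$ with respect to $B$: $B(\phi(x),y)=B(x,\phi^\dagger(y))$ for all $x,y\in V$. A superalgebra structure on a $K$-algebra $A$ is a vector space decomposition $A=A^{(0)}\oplus A^{(1)}$ with $A^{(i)}A^{(j)}\subseteq A^{(i+j\bmod 2)}$ for all $i,j\in\{0,1\}$. Products in $\mathrm{End}_K(V)$ are compositions.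
   Formalization: The direct sum decomposition and its orthogonality are proved only when B(w,w) ≠ 0, since for B(w,w) = 0 the non-zero map x ↦ B(x,w)w lies in both summands; the product inclusions and the symmetric bilinearity of the trace form are proved for every w ≠ 0. *)

theory Defs
  imports Complex_Main "HOL-Library.Function_Algebras"
begin

text \<open>
  The space \<open>V\<close> is a type \<open>'v\<close> with a scalar multiplication \<open>scale\<close> satisfying
  \<^const>\<open>finite_dimensional_vector_space\<close>. Endomorphisms are functions; their sum is the pointwise
  one of Function_Algebras, while their product is composition \<open>(\<circ>)\<close>, never the pointwise
  product \<open>(*)\<close>.
\<close>

subsection \<open>Forms, direct sums and superalgebras\<close>

definition symmetric_bilinear_form_on ::
    "('k::field \<Rightarrow> 'a::ab_group_add \<Rightarrow> 'a) \<Rightarrow> 'a set \<Rightarrow> ('a \<Rightarrow> 'a \<Rightarrow> 'k) \<Rightarrow> bool" where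
  "symmetric_bilinear_form_on s A F \<longleftrightarrow>
     (\<forall>x\<in>A. \<forall>y\<in>A. F x y = F y x) \<and>
     (\<forall>x\<in>A. \<forall>y\<in>A. \<forall>z\<in>A. F (x + y) z = F x z + F y z) \<and>
     (\<forall>x\<in>A. \<forall>y\<in>A. \<forall>z\<in>A. F x (y + z) = F x y + F x z) \<and>
     (\<forall>c. \<forall>x\<in>A. \<forall>y\<in>A. F (s c x) y = c * F x y) \<and>
     (\<forall>c. \<forall>x\<in>A. \<forall>y\<in>A. F x (s c y) = c * F x y)"

definition nondegenerate :: "('v::zero \<Rightarrow> 'v \<Rightarrow> 'k::zero) \<Rightarrow> bool" where
  "nondegenerate B \<longleftrightarrow> (\<forall>x. (\<forall>y. B x y = 0) \<longrightarrow> x = 0)"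

definition is_direct_sum ::
    "('k::field \<Rightarrow> 'a::ab_group_add \<Rightarrow> 'a) \<Rightarrow> 'a set \<Rightarrow> 'a set \<Rightarrow> 'a set \<Rightarrow> bool" where
  "is_direct_sum s A A0 A1 \<longleftrightarrow>
     module.subspace s A0 \<and> module.subspace s A1 \<and>
     A = {x + y |x y. x \<in> A0 \<and> y \<in> A1} \<and> A0 \<inter> A1 = {0}"

text \<open>The grading is indexed by the numbers 0 and 1; \<open>m\<close> is the product of the algebra.\<close>

definition graded_mult :: "('a \<Rightarrow> 'a \<Rightarrow> 'a) \<Rightarrow> (nat \<Rightarrow> 'a set) \<Rightarrow> bool" where
  "graded_mult m G \<longleftrightarrow>
     (\<forall>i\<in>{0, 1}. \<forall>j\<in>{0, 1}. \<forall>x\<in>G i. \<forall>y\<in>G j. m x y \<in> G ((i + j) mod 2))"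

definition superalgebra_structure ::
    "('k::field \<Rightarrow> 'a::ab_group_add \<Rightarrow> 'a) \<Rightarrow> ('a \<Rightarrow> 'a \<Rightarrow> 'a) \<Rightarrow> 'a set \<Rightarrow> (nat \<Rightarrow> 'a set) \<Rightarrow> bool" where
  "superalgebra_structure s m A G \<longleftrightarrow> is_direct_sum s A (G 0) (G 1) \<and> graded_mult m G"

subsection \<open>Endomorphisms\<close>

definition End :: "('k::field \<Rightarrow> 'v::ab_group_add \<Rightarrow> 'v) \<Rightarrow> ('v \<Rightarrow> 'v) set" where
  "End scale = {\<phi>. Vector_Spaces.linear scale scale \<phi>}"

definition end_scale :: "('k \<Rightarrow> 'v \<Rightarrow> 'v) \<Rightarrow> 'k \<Rightarrow> ('v \<Rightarrow> 'v) \<Rightarrow> 'v \<Rightarrow> 'v" where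
  "end_scale scale c \<phi> = (\<lambda>x. scale c (\<phi> x))"

lemma vector_space_end_scale:
  assumes "vector_space scale"
  shows "vector_space (end_scale scale)"
proof -
  interpret vector_space scale by fact
  show ?thesis
    by unfold_locales (auto simp: end_scale_def fun_eq_iff scale_right_distrib scale_left_distrib)
qed

text \<open>
  Sum of the diagonal entries of the matrix of \<open>\<phi>\<close> with respect to the basis \<open>Basis\<close>; the
  value does not depend on the basis.
\<close>

definition trace_wrt ::
    "('k::field \<Rightarrow> 'v::ab_group_add \<Rightarrow> 'v) \<Rightarrow> 'v set \<Rightarrow> ('v \<Rightarrow> 'v) \<Rightarrow> 'k" where
  "trace_wrt scale Basis \<phi> = (\<Sum>b\<in>Basis. module.representation scale Basis (\<phi> b) b)"

text \<open>Exists and is unique when \<open>B\<close> is a non-degenerate form in finite dimension.\<close>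

definition adjoint_wrt ::
    "('k::field \<Rightarrow> 'v::ab_group_add \<Rightarrow> 'v) \<Rightarrow> ('v \<Rightarrow> 'v \<Rightarrow> 'k) \<Rightarrow> ('v \<Rightarrow> 'v) \<Rightarrow> 'v \<Rightarrow> 'v" where
  "adjoint_wrt scale B \<phi> = (THE \<psi>. \<psi> \<in> End scale \<and> (\<forall>x y. B (\<phi> x) y = B x (\<psi> y)))"

definition trace_form ::
    "('k::field \<Rightarrow> 'v::ab_group_add \<Rightarrow> 'v) \<Rightarrow> 'v set \<Rightarrow> ('v \<Rightarrow> 'v \<Rightarrow> 'k) \<Rightarrow>
     ('v \<Rightarrow> 'v) \<Rightarrow> ('v \<Rightarrow> 'v) \<Rightarrow> 'k" where
  "trace_form scale Basis B \<phi>1 \<phi>2 = trace_wrt scale Basis (adjoint_wrt scale B \<phi>1 \<circ> \<phi>2)"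

subsection \<open>The two summands\<close>

definition perp :: "('v \<Rightarrow> 'v \<Rightarrow> 'k::zero) \<Rightarrow> 'v \<Rightarrow> 'v set" where
  "perp B w = {u. B u w = 0}"

definition E0 ::
    "('k::field \<Rightarrow> 'v::ab_group_add \<Rightarrow> 'v) \<Rightarrow> ('v \<Rightarrow> 'v \<Rightarrow> 'k) \<Rightarrow> 'v \<Rightarrow> ('v \<Rightarrow> 'v) set" where
  "E0 scale B w = {\<phi> \<in> End scale. \<forall>u\<in>perp B w. B u (\<phi> w) = 0 \<and> B w (\<phi> u) = 0}"

definition E1 ::
    "('k::field \<Rightarrow> 'v::ab_group_add \<Rightarrow> 'v) \<Rightarrow> ('v \<Rightarrow> 'v \<Rightarrow> 'k) \<Rightarrow> 'v \<Rightarrow> ('v \<Rightarrow> 'v) set" where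
  "E1 scale B w =
     {\<phi> \<in> End scale. (\<forall>u\<in>perp B w. \<forall>v\<in>perp B w. B u (\<phi> v) = 0) \<and> B w (\<phi> w) = 0}"

definition E_part ::
    "('k::field \<Rightarrow> 'v::ab_group_add \<Rightarrow> 'v) \<Rightarrow> ('v \<Rightarrow> 'v \<Rightarrow> 'k) \<Rightarrow> 'v \<Rightarrow> nat \<Rightarrow> ('v \<Rightarrow> 'v) set" where
  "E_part scale B w i = (if i = 0 then E0 scale B w else E1 scale B w)"

text \<open>
  For an isotropic vector \<open>w\<close> the two subspaces always have a common non-zero element, namely
  \<open>x \<mapsto> B(x,w) w\<close>, so their sum is not direct.
\<close>

lemma isotropic_not_direct_sum:
  fixes scale :: "'k::field \<Rightarrow> 'v::ab_group_add \<Rightarrow> 'v"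
  assumes vs: "vector_space scale"
    and B: "symmetric_bilinear_form_on scale UNIV B" "nondegenerate B"
    and w: "w \<noteq> 0" "B w w = 0"
  shows "\<not> is_direct_sum (end_scale scale) (End scale) (E0 scale B w) (E1 scale B w)"
proof
  assume ds: "is_direct_sum (end_scale scale) (End scale) (E0 scale B w) (E1 scale B w)"
  interpret V: vector_space scale by fact
  define \<phi> where "\<phi> = (\<lambda>x. scale (B x w) w)"
  have sym: "B x y = B y x" and add: "B (x + y) z = B x z + B y z"
    and sc: "B (scale c x) y = c * B x y" "B x (scale c y) = c * B x y" for x y z c
    using B(1) unfolding symmetric_bilinear_form_on_def by blast+
  have lin: "\<phi> \<in> End scale"
    unfolding End_def \<phi>_def mem_Collect_eq
    by unfold_locales (simp_all add: add sc V.scale_left_distrib)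
  have zero: "B x 0 = 0" for x using sc(2)[of x 0 0] by simp
  have "\<phi> \<in> E0 scale B w" "\<phi> \<in> E1 scale B w"
    using lin w by (auto simp: E0_def E1_def \<phi>_def perp_def sc zero)
  then have "\<phi> = 0" using ds by (auto simp: is_direct_sum_def)
  then have "scale (B x w) w = 0" for x
    unfolding \<phi>_def by (metis zero_fun_apply)
  then have "B x w = 0" for x using w by simp
  then have "B w x = 0" for x by (metis sym)
  then show False using B(2) w unfolding nondegenerate_def by blast
qed

end

theory Submission
  imports Defs
begin

text \<open>
  Let \<open>W\<close> be the orthogonal complement of \<open>w\<close>. Since \<open>B\<close> is non-degenerate, the orthogonal
  complement of \<open>W\<close> is the line \<open>K w\<close>, isotropic \<open>w\<close> included (lemma \<open>perp_perp\<close>). Hence the even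
  endomorphisms are those that preserve both \<open>K w\<close> and \<open>W\<close>, and the odd ones are those that map
  \<open>K w\<close> into \<open>W\<close> and \<open>W\<close> into \<open>K w\<close> (lemmas \<open>E0_iff\<close> and \<open>E1_iff\<close>). This makes the multiplication
  rules immediate.

  If \<open>B w w \<noteq> 0\<close>, then \<open>V = K w \<oplus> W\<close>. Let \<open>\<sigma>\<close> be the involution that is \<open>1\<close> on \<open>K w\<close> and \<open>- 1\<close> on
  \<open>W\<close>. The even endomorphisms are those that commute with \<open>\<sigma>\<close> and the odd ones those that
  anticommute with it, so the two summands are the eigenspaces of the involution
  \<open>\<phi> \<mapsto> \<sigma> \<phi> \<sigma>\<close>. As \<open>2 \<noteq> 0\<close>, their sum is direct and is everything. An odd \<open>\<chi>\<close> satisfies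
  \<open>\<chi> = - \<sigma> \<chi> \<sigma>\<close>, so its trace vanishes by the cyclicity of the trace. If \<open>\<phi>\<^sub>1\<close> is even and \<open>\<phi>\<^sub>2\<close> is
  odd, then the adjoint of \<open>\<phi>\<^sub>1\<close> is even as well, so its product with \<open>\<phi>\<^sub>2\<close> is odd and has trace
  zero, which is the orthogonality.

  Adjoints and traces are computed with the basis \<open>d\<close> dual to the given one with respect to \<open>B\<close>:
  the trace of \<open>\<phi>\<close> is \<open>\<Sum>b. B (\<phi> b) (d b)\<close>. It is invariant under adjoints, and
  \<open>Tr (\<phi>\<^sub>1\<^sup>\<dagger> \<phi>\<^sub>2) = Tr (\<phi>\<^sub>2\<^sup>\<dagger> \<phi>\<^sub>1)\<close> follows.
\<close>

section \<open>Non-degenerate symmetric bilinear forms\<close>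

locale nondegenerate_symmetric_form = finite_dimensional_vector_space scale Basis
  for scale :: "'k::field \<Rightarrow> 'v::ab_group_add \<Rightarrow> 'v" and Basis :: "'v set" +
  fixes B :: "'v \<Rightarrow> 'v \<Rightarrow> 'k"
  assumes form: "symmetric_bilinear_form_on scale UNIV B"
    and nondeg: "nondegenerate B"
begin

lemma B_sym: "B x y = B y x"
  and B_add: "B (x + y) z = B x z + B y z" "B x (y + z) = B x y + B x z"
  and B_scale: "B (scale c x) y = c * B x y" "B x (scale c y) = c * B x y"
  using form unfolding symmetric_bilinear_form_on_def by blast+

lemma B_zero: "B 0 x = 0" "B x 0 = 0"
  using B_scale(1)[of 0 0 x] B_scale(2)[of x 0 0] by simp_all

lemma B_minus: "B (- x) y = - B x y" "B x (- y) = - B x y"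
  using B_scale(1)[of "- 1" x y] B_scale(2)[of x "- 1" y] by simp_all

lemma B_diff: "B (x - y) z = B x z - B y z" "B x (y - z) = B x y - B x z"
  using B_add(1)[of x "- y" z] B_add(2)[of x y "- z"] by (simp_all add: B_minus)

lemma B_sum: "B (sum f A) y = (\<Sum>a\<in>A. B (f a) y)" "B y (sum f A) = (\<Sum>a\<in>A. B y (f a))"
  by (induction A rule: infinite_finite_induct) (simp_all add: B_zero B_add)

lemmas B_simps = B_add B_scale B_zero B_minus B_diff B_sum

lemma B_eqI:
  assumes "\<And>u. B u x = B u y"
  shows "x = y"
proof -
  have "\<forall>u. B (x - y) u = 0"
    using assms by (metis B_diff(1) B_sym eq_iff_diff_eq_0)
  then show ?thesis
    using nondeg unfolding nondegenerate_def by (metis eq_iff_diff_eq_0)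
qed

lemma End_iff:
  "\<phi> \<in> End scale \<longleftrightarrow>
    (\<forall>x y. \<phi> (x + y) = \<phi> x + \<phi> y) \<and> (\<forall>c x. \<phi> (scale c x) = scale c (\<phi> x))"
  using vector_space_axioms by (simp add: End_def Vector_Spaces.linear_iff)

lemma End_add: "\<phi> \<in> End scale \<Longrightarrow> \<phi> (x + y) = \<phi> x + \<phi> y"
  and End_scale: "\<phi> \<in> End scale \<Longrightarrow> \<phi> (scale c x) = scale c (\<phi> x)"
  by (simp_all add: End_iff)

lemma End_zero: "\<phi> \<in> End scale \<Longrightarrow> \<phi> 0 = 0"
  using End_scale[of \<phi> 0 0] by simp

lemma End_minus: "\<phi> \<in> End scale \<Longrightarrow> \<phi> (- x) = - \<phi> x"
  using End_scale[of \<phi> "- 1" x] by simp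

lemma End_diff: "\<phi> \<in> End scale \<Longrightarrow> \<phi> (x - y) = \<phi> x - \<phi> y"
  using End_add[of \<phi> x "- y"] by (simp add: End_minus)

lemma End_sum: "\<phi> \<in> End scale \<Longrightarrow> \<phi> (sum f A) = (\<Sum>a\<in>A. \<phi> (f a))"
  by (induction A rule: infinite_finite_induct) (simp_all add: End_zero End_add)

lemma End_comp: "\<phi> \<in> End scale \<Longrightarrow> \<psi> \<in> End scale \<Longrightarrow> \<phi> \<circ> \<psi> \<in> End scale"
  by (simp add: End_iff)

lemma End_plus: "\<phi> \<in> End scale \<Longrightarrow> \<psi> \<in> End scale \<Longrightarrow> \<phi> + \<psi> \<in> End scale"
  by (simp add: End_iff scale_right_distrib)

lemma End_end_scale: "\<phi> \<in> End scale \<Longrightarrow> end_scale scale c \<phi> \<in> End scale"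
  by (simp add: End_iff end_scale_def scale_right_distrib mult.commute)

lemma End_0: "0 \<in> End scale"
  by (simp add: End_iff)

section \<open>Dual basis, adjoints and trace\<close>

text \<open>
  The map \<open>x \<mapsto> \<Sum>c. B(c,x) c\<close> is injective because \<open>B\<close> is non-degenerate, hence onto in finite
  dimension; a preimage of the basis vector \<open>b\<close> is the dual basis vector.
\<close>

lemma ex_dual_vector:
  assumes "b \<in> Basis"
  shows "\<exists>d. \<forall>c\<in>Basis. B c d = (if c = b then 1 else 0)"
proof -
  define T where "T = (\<lambda>x. \<Sum>c\<in>Basis. scale (B c x) c)"
  have T: "T \<in> End scale"
    by (simp add: End_iff T_def B_simps scale_left_distrib sum.distrib scale_sum_right)
  have rep: "representation Basis (T x) c = B c x" if "c \<in> Basis" for x c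
  proof -
    have "representation Basis (T x) c = (\<Sum>b\<in>Basis. B b x * representation Basis b c)"
      unfolding T_def using independent_Basis span_Basis
      by (simp add: representation_sum representation_scale)
    also have "\<dots> = (\<Sum>b\<in>Basis. if b = c then B b x else 0)"
      using independent_Basis by (intro sum.cong) (auto simp: representation_basis)
    finally show ?thesis
      using that finite_Basis by simp
  qed
  have "x = 0" if "T x = 0" for x
  proof (rule B_eqI)
    fix u
    have "B c x = 0" if "c \<in> Basis" for c
      using rep[OF that, of x] \<open>T x = 0\<close> by (simp add: representation_zero)
    moreover have "u = (\<Sum>c\<in>Basis. scale (representation Basis u c) c)"
      using sum_representation_eq[of Basis u Basis] independent_Basis span_Basis finite_Basis
      by simp
    ultimately have "B u x = 0"
      by (metis (no_types, lifting) B_sum(1) B_scale(1) mult_zero_right sum.neutral)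
    then show "B u x = B u 0"
      by (simp add: B_zero)
  qed
  then have "inj T"
    using End_diff[OF T] by (metis eq_iff_diff_eq_0 injI)
  then have "surj T"
    using T linear_inj_imp_surj unfolding End_def by blast
  then obtain d where "T d = b"
    by (metis surjD)
  then have "B c d = (if c = b then 1 else 0)" if "c \<in> Basis" for c
    using rep[OF that, of d] representation_basis[OF independent_Basis assms] by auto
  then show ?thesis
    by blast
qed

definition dual_vector :: "'v \<Rightarrow> 'v" where
  "dual_vector b = (SOME d. \<forall>c\<in>Basis. B c d = (if c = b then 1 else 0))"

lemma B_dual_vector:
  "b \<in> Basis \<Longrightarrow> c \<in> Basis \<Longrightarrow> B c (dual_vector b) = (if c = b then 1 else 0)"
  using someI_ex[OF ex_dual_vector] unfolding dual_vector_def by blast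

lemma representation_eq_B:
  assumes "b \<in> Basis"
  shows "representation Basis x b = B x (dual_vector b)"
proof -
  have "x = (\<Sum>c\<in>Basis. scale (representation Basis x c) c)"
    using sum_representation_eq[of Basis x Basis] independent_Basis span_Basis finite_Basis
    by simp
  then have "B x (dual_vector b) =
      (\<Sum>c\<in>Basis. representation Basis x c * B c (dual_vector b))"
    by (metis (no_types, lifting) B_sum(1) B_scale(1) sum.cong)
  also have "\<dots> = (\<Sum>c\<in>Basis. if c = b then representation Basis x c else 0)"
    using assms by (intro sum.cong) (auto simp: B_dual_vector)
  finally show ?thesis
    using assms finite_Basis by simp
qed

lemma dual_expansion: "(\<Sum>b\<in>Basis. scale (B x (dual_vector b)) b) = x"
proof -
  have "(\<Sum>b\<in>Basis. scale (B x (dual_vector b)) b) =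
      (\<Sum>b\<in>Basis. scale (representation Basis x b) b)"
    by (intro sum.cong) (simp_all add: representation_eq_B)
  then show ?thesis
    using sum_representation_eq[of Basis x Basis] independent_Basis span_Basis finite_Basis
    by simp
qed

lemma B_expansion:
  assumes "\<phi> \<in> End scale"
  shows "(\<Sum>b\<in>Basis. B x (dual_vector b) * B (\<phi> b) y) = B (\<phi> x) y"
proof -
  have "\<phi> x = (\<Sum>b\<in>Basis. scale (B x (dual_vector b)) (\<phi> b))"
    using arg_cong[OF dual_expansion[of x], of \<phi>] assms by (simp add: End_sum End_scale)
  then show ?thesis
    by (simp add: B_simps)
qed

lemma adjoint_unique:
  assumes "\<psi> \<in> End scale" "\<And>x y. B (\<phi> x) y = B x (\<psi> y)"
  shows "adjoint_wrt scale B \<phi> = \<psi>"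
  unfolding adjoint_wrt_def
proof (rule the_equality)
  show "\<psi> \<in> End scale \<and> (\<forall>x y. B (\<phi> x) y = B x (\<psi> y))"
    using assms by blast
  fix \<psi>' assume "\<psi>' \<in> End scale \<and> (\<forall>x y. B (\<phi> x) y = B x (\<psi>' y))"
  then show "\<psi>' = \<psi>"
    using assms(2) by (intro ext B_eqI) metis
qed

lemma
  assumes "\<phi> \<in> End scale"
  shows adjoint_End: "adjoint_wrt scale B \<phi> \<in> End scale"
    and B_adjoint: "B (\<phi> x) y = B x (adjoint_wrt scale B \<phi> y)"
proof -
  \<comment> \<open>The coordinates of the adjoint at \<open>y\<close> in the dual basis are its pairings with the basis.\<close>
  define \<psi> where "\<psi> = (\<lambda>y. \<Sum>b\<in>Basis. scale (B (\<phi> b) y) (dual_vector b))"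
  have \<psi>: "\<psi> \<in> End scale"
    by (simp add: End_iff \<psi>_def B_simps scale_left_distrib sum.distrib scale_sum_right)
  have adj: "B (\<phi> x) y = B x (\<psi> y)" for x y
    using B_expansion[OF assms, of x y] by (simp add: \<psi>_def B_simps mult.commute)
  have "adjoint_wrt scale B \<phi> = \<psi>"
    using \<psi> adj by (rule adjoint_unique)
  then show "adjoint_wrt scale B \<phi> \<in> End scale" "B (\<phi> x) y = B x (adjoint_wrt scale B \<phi> y)"
    using \<psi> adj by simp_all
qed

lemma B_adjoint': "\<phi> \<in> End scale \<Longrightarrow> B (adjoint_wrt scale B \<phi> x) y = B x (\<phi> y)"
  by (metis B_adjoint B_sym)

lemma adjoint_add:
  assumes "\<phi> \<in> End scale" "\<psi> \<in> End scale"
  shows "adjoint_wrt scale B (\<phi> + \<psi>) = adjoint_wrt scale B \<phi> + adjoint_wrt scale B \<psi>"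
  using assms by (intro adjoint_unique) (simp_all add: End_plus adjoint_End B_simps B_adjoint)

lemma adjoint_end_scale:
  assumes "\<phi> \<in> End scale"
  shows "adjoint_wrt scale B (end_scale scale c \<phi>) = end_scale scale c (adjoint_wrt scale B \<phi>)"
  using adjoint_unique[of "end_scale scale c (adjoint_wrt scale B \<phi>)" "end_scale scale c \<phi>"]
    assms End_end_scale[OF adjoint_End[OF assms], of c]
  by (simp add: end_scale_def B_simps B_adjoint)

lemma trace_eq_sum_B: "trace_wrt scale Basis \<phi> = (\<Sum>b\<in>Basis. B (\<phi> b) (dual_vector b))"
  unfolding trace_wrt_def by (intro sum.cong) (simp_all add: representation_eq_B)

text \<open>
  Both traces expand to \<open>\<Sum>b. \<Sum>c. B(d(b),d(c)) B(\<psi>(c),b)\<close>, where \<open>d\<close> is the dual basis: for the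
  adjoint by writing \<open>d(b)\<close> in the basis, for \<open>\<psi>\<close> by writing \<open>d(c)\<close> in the basis.
\<close>

lemma trace_adjoint:
  assumes "\<psi> \<in> End scale"
  shows "trace_wrt scale Basis (adjoint_wrt scale B \<psi>) = trace_wrt scale Basis \<psi>"
proof -
  let ?d = dual_vector
  have id: "(\<lambda>x. x) \<in> End scale"
    by (simp add: End_iff)
  have "trace_wrt scale Basis (adjoint_wrt scale B \<psi>) = (\<Sum>b\<in>Basis. B (\<psi> (?d b)) b)"
    unfolding trace_eq_sum_B by (intro sum.cong refl) (metis B_adjoint'[OF assms] B_sym)
  also have "\<dots> = (\<Sum>b\<in>Basis. \<Sum>c\<in>Basis. B (?d b) (?d c) * B (\<psi> c) b)"
    by (simp add: B_expansion[OF assms])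
  also have "\<dots> = (\<Sum>c\<in>Basis. \<Sum>b\<in>Basis. B (?d c) (?d b) * B b (\<psi> c))"
    by (subst sum.swap) (simp add: B_sym)
  also have "\<dots> = (\<Sum>c\<in>Basis. B (?d c) (\<psi> c))"
    by (simp add: B_expansion[OF id])
  also have "\<dots> = trace_wrt scale Basis \<psi>"
    unfolding trace_eq_sum_B by (simp add: B_sym)
  finally show ?thesis .
qed

lemma trace_comp_commute:
  assumes "\<phi> \<in> End scale" "\<psi> \<in> End scale"
  shows "trace_wrt scale Basis (\<phi> \<circ> \<psi>) = trace_wrt scale Basis (\<psi> \<circ> \<phi>)"
proof -
  let ?d = dual_vector
  have expand: "trace_wrt scale Basis (\<alpha> \<circ> \<beta>) =
      (\<Sum>b\<in>Basis. \<Sum>c\<in>Basis. B (\<beta> b) (?d c) * B (\<alpha> c) (?d b))" if "\<alpha> \<in> End scale" for \<alpha> \<beta>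
    unfolding trace_eq_sum_B by (simp add: B_expansion[OF that])
  show ?thesis
    unfolding expand[OF assms(1)] expand[OF assms(2)]
    by (subst sum.swap) (simp add: mult.commute)
qed

lemma trace_add:
  "trace_wrt scale Basis (\<phi> + \<psi>) = trace_wrt scale Basis \<phi> + trace_wrt scale Basis \<psi>"
  by (simp add: trace_eq_sum_B B_simps sum.distrib)

lemma trace_end_scale:
  "trace_wrt scale Basis (end_scale scale c \<phi>) = c * trace_wrt scale Basis \<phi>"
  by (simp add: trace_eq_sum_B end_scale_def B_simps sum_distrib_left)

lemma trace_form_sym:
  assumes "\<phi> \<in> End scale" "\<psi> \<in> End scale"
  shows "trace_form scale Basis B \<phi> \<psi> = trace_form scale Basis B \<psi> \<phi>"
proof -
  let ?a = "adjoint_wrt scale B"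
  have "?a (?a \<phi> \<circ> \<psi>) = ?a \<psi> \<circ> \<phi>"
  proof (rule adjoint_unique)
    show "?a \<psi> \<circ> \<phi> \<in> End scale"
      using assms by (simp add: End_comp adjoint_End)
    show "B ((?a \<phi> \<circ> \<psi>) x) y = B x ((?a \<psi> \<circ> \<phi>) y)" for x y
      using B_adjoint'[OF assms(1), of "\<psi> x" y] B_adjoint[OF assms(2), of x "\<phi> y"] by simp
  qed
  then show ?thesis
    unfolding trace_form_def
    using trace_adjoint[OF End_comp[OF adjoint_End[OF assms(1)] assms(2)]] by simp
qed

lemma trace_form_bilinear:
  "symmetric_bilinear_form_on (end_scale scale) (End scale) (trace_form scale Basis B)"
proof -
  have add: "trace_form scale Basis B (x + y) z =
      trace_form scale Basis B x z + trace_form scale Basis B y z"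
    if "x \<in> End scale" "y \<in> End scale" for x y z
  proof -
    have "(adjoint_wrt scale B x + adjoint_wrt scale B y) \<circ> z =
        (adjoint_wrt scale B x \<circ> z) + (adjoint_wrt scale B y \<circ> z)"
      by (simp add: fun_eq_iff)
    then show ?thesis
      using that by (simp add: trace_form_def adjoint_add trace_add)
  qed
  have scale: "trace_form scale Basis B (end_scale scale c x) z = c * trace_form scale Basis B x z"
    if "x \<in> End scale" for x z c
  proof -
    have "end_scale scale c (adjoint_wrt scale B x) \<circ> z =
        end_scale scale c (adjoint_wrt scale B x \<circ> z)"
      by (simp add: fun_eq_iff end_scale_def)
    then show ?thesis
      using that by (simp add: trace_form_def adjoint_end_scale trace_end_scale)
  qed
  show ?thesis
    unfolding symmetric_bilinear_form_on_def
  proof (intro conjI ballI allI)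
    fix x y z c
    assume x: "x \<in> End scale" and y: "y \<in> End scale"
    show "trace_form scale Basis B x y = trace_form scale Basis B y x"
      using x y by (rule trace_form_sym)
    show "trace_form scale Basis B (end_scale scale c x) y = c * trace_form scale Basis B x y"
      using x by (rule scale)
    show "trace_form scale Basis B x (end_scale scale c y) = c * trace_form scale Basis B x y"
      using x y by (simp only: trace_form_sym[of x] End_end_scale scale)
    assume z: "z \<in> End scale"
    show "trace_form scale Basis B (x + y) z =
        trace_form scale Basis B x z + trace_form scale Basis B y z"
      using x y by (rule add)
    show "trace_form scale Basis B x (y + z) =
        trace_form scale Basis B x y + trace_form scale Basis B x z"
      using x y z by (simp only: trace_form_sym[of x] End_plus add)
  qed
qed

section \<open>The multiplication rules\<close>

text \<open>
  A vector \<open>z\<close> with \<open>B(z,w) \<noteq> 0\<close> spans a complement of the hyperplane orthogonal to \<open>w\<close>. If \<open>x\<close> is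
  orthogonal to that hyperplane, then subtracting from \<open>x\<close> a suitable multiple of \<open>w\<close> gives a vector
  that is orthogonal to \<open>z\<close> too, hence zero.
\<close>

lemma perp_perp:
  assumes "w \<noteq> 0"
  shows "(\<forall>u\<in>perp B w. B u x = 0) \<longleftrightarrow> (\<exists>c. x = scale c w)"
proof
  assume x: "\<forall>u\<in>perp B w. B u x = 0"
  obtain z where z: "B z w \<noteq> 0"
    using assms nondeg unfolding nondegenerate_def by (metis B_sym)
  have "B u x = B u (scale (B z x / B z w) w)" for u
  proof -
    have "u - scale (B u w / B z w) z \<in> perp B w"
      using z by (simp add: perp_def B_simps)
    then have "B (u - scale (B u w / B z w) z) x = 0"
      using x by blast
    then show ?thesis
      by (simp add: B_simps)
  qed
  then show "\<exists>c. x = scale c w"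
    using B_eqI by blast
qed (auto simp: perp_def B_simps)

lemma E0_iff:
  assumes "w \<noteq> 0"
  shows "\<phi> \<in> E0 scale B w \<longleftrightarrow>
    \<phi> \<in> End scale \<and> (\<exists>c. \<phi> w = scale c w) \<and> (\<forall>u\<in>perp B w. \<phi> u \<in> perp B w)"
  unfolding E0_def perp_perp[OF assms, symmetric] by (auto simp: perp_def B_sym)

lemma E1_iff:
  assumes "w \<noteq> 0"
  shows "\<phi> \<in> E1 scale B w \<longleftrightarrow>
    \<phi> \<in> End scale \<and> \<phi> w \<in> perp B w \<and> (\<forall>u\<in>perp B w. \<exists>c. \<phi> u = scale c w)"
  unfolding E1_def perp_perp[OF assms, symmetric] by (auto simp: perp_def B_sym)

lemma perp_scale: "x \<in> perp B w \<Longrightarrow> scale c x \<in> perp B w"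
  by (simp add: perp_def B_simps)

lemma
  assumes "w \<noteq> 0"
  shows E0_E0: "\<phi> \<in> E0 scale B w \<Longrightarrow> \<psi> \<in> E0 scale B w \<Longrightarrow> \<phi> \<circ> \<psi> \<in> E0 scale B w"
    and E0_E1: "\<phi> \<in> E0 scale B w \<Longrightarrow> \<psi> \<in> E1 scale B w \<Longrightarrow> \<phi> \<circ> \<psi> \<in> E1 scale B w"
    and E1_E0: "\<phi> \<in> E1 scale B w \<Longrightarrow> \<psi> \<in> E0 scale B w \<Longrightarrow> \<phi> \<circ> \<psi> \<in> E1 scale B w"
    and E1_E1: "\<phi> \<in> E1 scale B w \<Longrightarrow> \<psi> \<in> E1 scale B w \<Longrightarrow> \<phi> \<circ> \<psi> \<in> E0 scale B w"
  unfolding E0_iff[OF assms] E1_iff[OF assms]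
  by (fastforce simp: End_comp End_scale perp_scale)+

lemma graded_mult_E_part:
  assumes "w \<noteq> 0"
  shows "graded_mult (\<circ>) (E_part scale B w)"
  using E0_E0 E0_E1 E1_E0 E1_E1 assms by (auto simp: graded_mult_def E_part_def)

text \<open>
  The two conditions that define an even endomorphism are exchanged by taking adjoints.
\<close>

lemma adjoint_E0:
  assumes "\<phi> \<in> E0 scale B w"
  shows "adjoint_wrt scale B \<phi> \<in> E0 scale B w"
proof -
  have "\<phi> \<in> End scale"
    using assms by (simp add: E0_def)
  then show ?thesis
    using assms by (auto simp: E0_def adjoint_End B_adjoint[symmetric] B_sym)
qed

section \<open>The grading involution\<close>

text \<open>
  For \<open>B w w \<noteq> 0\<close> this is \<open>1\<close> on the line of \<open>w\<close> and \<open>- 1\<close> on its orthogonal complement, that is,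
  the negative of the orthogonal reflection in the hyperplane orthogonal to \<open>w\<close>.
\<close>

definition line_reflection :: "'v \<Rightarrow> 'v \<Rightarrow> 'v" where
  "line_reflection w x = scale (2 * B x w / B w w) w - x"

lemma line_reflection_End: "line_reflection w \<in> End scale"
  by (simp add: End_iff line_reflection_def B_simps scale_left_distrib scale_right_diff_distrib
      distrib_left add_divide_distrib mult.left_commute)

lemma line_reflection_involution:
  "B w w \<noteq> 0 \<Longrightarrow> line_reflection w (line_reflection w x) = x"
  by (simp add: line_reflection_def B_simps scale_left_distrib[symmetric]
      scale_left_diff_distrib[symmetric] diff_divide_distrib right_diff_distrib)

lemma line_reflection_fixed_iff:
  assumes "(2::'k) \<noteq> 0" "B w w \<noteq> 0"
  shows "line_reflection w x = x \<longleftrightarrow> (\<exists>c. x = scale c w)"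
proof
  assume "line_reflection w x = x"
  then have "scale 2 x = scale (2 * (B x w / B w w)) w"
    unfolding line_reflection_def
    by (metis diff_eq_eq one_add_one scale_left_distrib scale_one times_divide_eq_right)
  then have "scale 2 x = scale 2 (scale (B x w / B w w) w)"
    by simp
  then show "\<exists>c. x = scale c w"
    using assms(1) scale_cancel_left by blast
next
  assume "\<exists>c. x = scale c w"
  then show "line_reflection w x = x"
    using assms(2)
    by (auto simp: line_reflection_def B_simps scale_left_diff_distrib[symmetric])
qed

lemma line_reflection_negated_iff:
  assumes "(2::'k) \<noteq> 0" "B w w \<noteq> 0"
  shows "line_reflection w x = - x \<longleftrightarrow> x \<in> perp B w"
proof -
  have "w \<noteq> 0"
    using assms(2) B_zero by auto
  then show ?thesis
    using assms by (simp add: line_reflection_def perp_def)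
qed

text \<open>
  A vector that is not isotropic spans the space together with its orthogonal complement, as the
  orthogonal projection \<open>(B(x,w) / B(w,w)) w\<close> of \<open>x\<close> exists.
\<close>

lemma End_eqI_perp:
  assumes "B w w \<noteq> 0" "\<phi> \<in> End scale" "\<psi> \<in> End scale"
    and "\<phi> w = \<psi> w" "\<And>u. u \<in> perp B w \<Longrightarrow> \<phi> u = \<psi> u"
  shows "\<phi> = \<psi>"
proof
  fix x
  let ?c = "B x w / B w w"
  have x: "x = scale ?c w + (x - scale ?c w)"
    by simp
  have "x - scale ?c w \<in> perp B w"
    using assms(1) by (simp add: perp_def B_simps)
  then have "\<phi> (x - scale ?c w) = \<psi> (x - scale ?c w)"
    by (rule assms(5))
  then show "\<phi> x = \<psi> x"
    using assms(2-4) by (subst (1 2) x) (simp only: End_add End_scale)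
qed

text \<open>
  The line of \<open>w\<close> and its orthogonal complement are the two eigenspaces of the grading involution.
  Commuting with an involution amounts to preserving its eigenspaces, and anticommuting with it to
  exchanging them.
\<close>

lemma E0_iff_commutes:
  assumes "(2::'k) \<noteq> 0" "B w w \<noteq> 0"
  shows "\<phi> \<in> E0 scale B w \<longleftrightarrow>
    \<phi> \<in> End scale \<and> (\<forall>x. line_reflection w (\<phi> x) = \<phi> (line_reflection w x))"
    (is "_ \<longleftrightarrow> _ \<and> ?C")
proof (cases "\<phi> \<in> End scale")
  case True
  let ?\<sigma> = "line_reflection w"
  have w: "?\<sigma> w = w"
    unfolding line_reflection_fixed_iff[OF assms] by (metis scale_one)
  have u: "?\<sigma> u = - u" if "u \<in> perp B w" for u
    using that line_reflection_negated_iff[OF assms] by blast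
  have "?C \<longleftrightarrow> ?\<sigma> (\<phi> w) = \<phi> w \<and> (\<forall>u\<in>perp B w. ?\<sigma> (\<phi> u) = - \<phi> u)"
  proof
    assume ?C
    then show "?\<sigma> (\<phi> w) = \<phi> w \<and> (\<forall>u\<in>perp B w. ?\<sigma> (\<phi> u) = - \<phi> u)"
      using True by (simp add: w u End_minus)
  next
    assume "?\<sigma> (\<phi> w) = \<phi> w \<and> (\<forall>u\<in>perp B w. ?\<sigma> (\<phi> u) = - \<phi> u)"
    then have "?\<sigma> \<circ> \<phi> = \<phi> \<circ> ?\<sigma>"
      using True
      by (intro End_eqI_perp[OF assms(2)]) (simp_all add: End_comp line_reflection_End End_minus w u)
    then show ?C
      by (simp add: fun_eq_iff)
  qed
  then show ?thesis
    using True E0_iff[of w \<phi>] assms(2) B_zero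
    by (auto simp: line_reflection_fixed_iff[OF assms] line_reflection_negated_iff[OF assms])
qed (simp add: E0_def)

lemma E1_iff_anticommutes:
  assumes "(2::'k) \<noteq> 0" "B w w \<noteq> 0"
  shows "\<phi> \<in> E1 scale B w \<longleftrightarrow>
    \<phi> \<in> End scale \<and> (\<forall>x. line_reflection w (\<phi> x) = - \<phi> (line_reflection w x))"
    (is "_ \<longleftrightarrow> _ \<and> ?C")
proof (cases "\<phi> \<in> End scale")
  case True
  let ?\<sigma> = "line_reflection w"
  have w: "?\<sigma> w = w"
    unfolding line_reflection_fixed_iff[OF assms] by (metis scale_one)
  have u: "?\<sigma> u = - u" if "u \<in> perp B w" for u
    using that line_reflection_negated_iff[OF assms] by blast
  have "?C \<longleftrightarrow> ?\<sigma> (\<phi> w) = - \<phi> w \<and> (\<forall>u\<in>perp B w. ?\<sigma> (\<phi> u) = \<phi> u)"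
  proof
    assume ?C
    then show "?\<sigma> (\<phi> w) = - \<phi> w \<and> (\<forall>u\<in>perp B w. ?\<sigma> (\<phi> u) = \<phi> u)"
      using True by (simp add: w u End_minus)
  next
    assume *: "?\<sigma> (\<phi> w) = - \<phi> w \<and> (\<forall>u\<in>perp B w. ?\<sigma> (\<phi> u) = \<phi> u)"
    have "?\<sigma> \<circ> \<phi> = end_scale scale (- 1) (\<phi> \<circ> ?\<sigma>)"
      using True *
      by (intro End_eqI_perp[OF assms(2)])
        (simp_all add: End_comp End_end_scale line_reflection_End End_minus w u,
         simp_all add: end_scale_def End_minus w u)
    then show ?C
      by (simp add: fun_eq_iff end_scale_def)
  qed
  then show ?thesis
    using True E1_iff[of w \<phi>] assms(2) B_zero
    by (auto simp: line_reflection_fixed_iff[OF assms] line_reflection_negated_iff[OF assms])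
qed (simp add: E1_def)

lemma subspace_E0: "module.subspace (end_scale scale) (E0 scale B w)"
proof -
  interpret E: vector_space "end_scale scale"
    using vector_space_axioms by (rule vector_space_end_scale)
  show ?thesis
    unfolding E.subspace_def
    by (auto simp: E0_def End_0 End_plus End_end_scale B_simps) (simp_all add: end_scale_def B_simps)
qed

lemma subspace_E1: "module.subspace (end_scale scale) (E1 scale B w)"
proof -
  interpret E: vector_space "end_scale scale"
    using vector_space_axioms by (rule vector_space_end_scale)
  show ?thesis
    unfolding E.subspace_def
    by (auto simp: E1_def End_0 End_plus End_end_scale B_simps) (simp_all add: end_scale_def B_simps)
qed

text \<open>
  The components of \<open>\<phi>\<close> are its projections \<open>(\<phi> \<plusminus> \<sigma> \<phi> \<sigma>) / 2\<close> to the eigenspaces of conjugation by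
  the grading involution \<open>\<sigma>\<close>.
\<close>

lemma direct_sum_E0_E1:
  assumes two: "(2::'k) \<noteq> 0" and w: "B w w \<noteq> 0"
  shows "is_direct_sum (end_scale scale) (End scale) (E0 scale B w) (E1 scale B w)"
proof -
  let ?\<sigma> = "line_reflection w"
  have half: "scale (1 / 2) x + scale (1 / 2) x = x" for x
    using two by (simp add: scale_left_distrib[symmetric])
  have double: "x = 0" if "x = - x" for x :: 'v
  proof -
    have "scale 2 x = 0"
      using that by (metis add.right_inverse one_add_one scale_left_distrib scale_one)
    then show ?thesis
      using two by simp
  qed
  have "\<exists>\<phi>0\<in>E0 scale B w. \<exists>\<phi>1\<in>E1 scale B w. \<phi> = \<phi>0 + \<phi>1" if \<phi>: "\<phi> \<in> End scale" for \<phi>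
  proof (intro bexI)
    let ?\<phi>' = "?\<sigma> \<circ> \<phi> \<circ> ?\<sigma>"
    define \<phi>0 where "\<phi>0 = end_scale scale (1 / 2) (\<phi> + ?\<phi>')"
    define \<phi>1 where "\<phi>1 = end_scale scale (1 / 2) (\<phi> + end_scale scale (- 1) ?\<phi>')"
    have End: "\<phi>0 \<in> End scale" "\<phi>1 \<in> End scale"
      unfolding \<phi>0_def \<phi>1_def
      using \<phi> by (intro End_end_scale End_plus End_comp line_reflection_End; simp)+
    show "\<phi> = \<phi>0 + \<phi>1"
      by (simp add: fun_eq_iff \<phi>0_def \<phi>1_def end_scale_def scale_right_distrib
          scale_right_diff_distrib half)
    note \<sigma> = End_add[OF line_reflection_End] End_scale[OF line_reflection_End]
      End_diff[OF line_reflection_End] line_reflection_involution[OF w]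
    show "\<phi>0 \<in> E0 scale B w"
      unfolding E0_iff_commutes[OF two w] using End(1)
      by (simp add: \<phi>0_def end_scale_def \<sigma> add.commute)
    show "\<phi>1 \<in> E1 scale B w"
      unfolding E1_iff_anticommutes[OF two w] using End(2)
      by (simp add: \<phi>1_def end_scale_def \<sigma> scale_right_diff_distrib)
  qed
  moreover have "\<phi> + \<psi> \<in> End scale" if "\<phi> \<in> E0 scale B w" "\<psi> \<in> E1 scale B w" for \<phi> \<psi>
    using that by (simp add: E0_def E1_def End_plus)
  ultimately have sum: "End scale = {x + y |x y. x \<in> E0 scale B w \<and> y \<in> E1 scale B w}"
    by blast
  have "\<phi> = 0" if "\<phi> \<in> E0 scale B w" "\<phi> \<in> E1 scale B w" for \<phi>
  proof
    fix x
    have "\<phi> (?\<sigma> (?\<sigma> x)) = - \<phi> (?\<sigma> (?\<sigma> x))"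
      using that E0_iff_commutes[OF two w] E1_iff_anticommutes[OF two w] by metis
    then show "\<phi> x = 0 x"
      using double by (simp add: line_reflection_involution[OF w])
  qed
  moreover have "0 \<in> E0 scale B w" "0 \<in> E1 scale B w"
    by (simp_all add: E0_def E1_def End_0 B_zero)
  ultimately have "E0 scale B w \<inter> E1 scale B w = {0}"
    by blast
  then show ?thesis
    unfolding is_direct_sum_def using sum subspace_E0 subspace_E1 by blast
qed

text \<open>
  Conjugation by the grading involution leaves the trace unchanged but negates \<open>\<chi>\<close>.
\<close>

lemma trace_E1:
  assumes two: "(2::'k) \<noteq> 0" and w: "B w w \<noteq> 0" and \<chi>: "\<chi> \<in> E1 scale B w"
  shows "trace_wrt scale Basis \<chi> = 0"
proof -
  let ?\<sigma> = "line_reflection w" and ?tr = "trace_wrt scale Basis"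
  have End: "\<chi> \<in> End scale" and anti: "\<And>x. ?\<sigma> (\<chi> x) = - \<chi> (?\<sigma> x)"
    using \<chi> E1_iff_anticommutes[OF two w] by auto
  have "?tr \<chi> = ?tr (\<chi> \<circ> ?\<sigma> \<circ> ?\<sigma>)"
    by (simp add: comp_def line_reflection_involution[OF w])
  also have "\<dots> = ?tr (?\<sigma> \<circ> (\<chi> \<circ> ?\<sigma>))"
    by (intro trace_comp_commute End_comp End line_reflection_End)
  also have "?\<sigma> \<circ> (\<chi> \<circ> ?\<sigma>) = end_scale scale (- 1) \<chi>"
    by (simp add: fun_eq_iff end_scale_def anti line_reflection_involution[OF w])
  also have "?tr \<dots> = - ?tr \<chi>"
    by (simp add: trace_end_scale)
  finally have "2 * ?tr \<chi> = 0"
    by (metis add.right_inverse mult_2)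
  then show ?thesis
    using two by simp
qed

lemma E0_E1_orthogonal:
  assumes "(2::'k) \<noteq> 0" "B w w \<noteq> 0" "\<phi> \<in> E0 scale B w" "\<psi> \<in> E1 scale B w"
  shows "trace_form scale Basis B \<phi> \<psi> = 0"
proof -
  have "w \<noteq> 0"
    using assms(2) B_zero by auto
  then have "adjoint_wrt scale B \<phi> \<circ> \<psi> \<in> E1 scale B w"
    using E0_E1 adjoint_E0 assms(3,4) by blast
  then show ?thesis
    unfolding trace_form_def using trace_E1 assms(1,2) by blast
qed

end

section \<open>The superalgebra structure\<close>

theorem theorem2p8:
  fixes scale :: "'k::field_char_0 \<Rightarrow> 'v::ab_group_add \<Rightarrow> 'v"
    and Basis :: "'v set"
    and B :: "'v \<Rightarrow> 'v \<Rightarrow> 'k"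
    and w :: 'v
  assumes "finite_dimensional_vector_space scale Basis"
    and "vector_space.dim scale (UNIV :: 'v set) \<ge> 2"
    and "symmetric_bilinear_form_on scale UNIV B"
    and "nondegenerate B"
    and "w \<noteq> 0"
  shows "symmetric_bilinear_form_on (end_scale scale) (End scale) (trace_form scale Basis B) \<and>
    graded_mult (\<circ>) (E_part scale B w) \<and>
    (B w w \<noteq> 0 \<longrightarrow>
      superalgebra_structure (end_scale scale) (\<circ>) (End scale) (E_part scale B w) \<and>
      (\<forall>\<phi>1\<in>E_part scale B w 0. \<forall>\<phi>2\<in>E_part scale B w 1. trace_form scale Basis B \<phi>1 \<phi>2 = 0))"
proof -
  interpret finite_dimensional_vector_space scale Basis
    by (rule assms(1))
  interpret nondegenerate_symmetric_form scale Basis B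
    using assms(3,4) by unfold_locales
  have two: "(2::'k) \<noteq> 0"
    by simp
  show ?thesis
    using trace_form_bilinear graded_mult_E_part[OF assms(5)] direct_sum_E0_E1[OF two]
      E0_E1_orthogonal[OF two]
    by (simp add: superalgebra_structure_def E_part_def)
qed

end
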